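(* Let $a<-1$ and let $f$, $\overline{\mathbf R^2}$, admissible words and the rectangles $R(w)$ be as in the context. If $w$ is a word such that both $w$ and $\sigma w$ are admissible, and if $(-a,\infty)\notin R(w)$, then $R(\sigma w)=f\,R(w)$.
   Context: Fix a real number $a<-1$. Let $\overline{\mathbf R^2}=(\mathbf R\cup\{\infty\})\times(\mathbf R\cup\{\infty\})$, with $+\infty$ and $-\infty$ identified to $\infty$ in each factor. The birational map $f(x,y)=\left(y\frac{x+a}{x-1},\,x+a-1\right)$, with inverse $f^{-1}(x,y)=\left(y+1-a,\,x\frac{y-a}{y+1}\right)$, extends continuously to $\overline{\mathbf R^2}\setminus I(f)$, resp. $\overline{\mathbf R^2}\setminus I(f^{-1})$, where $I(f)=\{(1,0),(-a,\infty)\}$ and $I(f^{-1})=\{(0,-1),(\infty,a)\}$ are the indeterminacy sets. For a compact set $S\subset\overline{\mathbf R^2}$, $f(S)$ denotes the closure of $f(S\setminus I(f))$. Rectangles: $R_0=[1,\infty]\times[-\infty,-1]$ and $R_1=[-\infty,0]\times[0,\infty]$. Words: $\Sigma\subset\{0,1\}^{\mathbf Z}$ is the set of bi-infinite sequences in which the block $11$ does not occur. An admissible word is a subword $w=w[-n,m]=w_{-n}\dots w_m$ (finite or infinite) of an element of $\Sigma$ whose extent $[-n,m]$ satisfies $0\le n,m\le\infty$. The shift is $(\sigma w)_j=w_{j+1}$ (so $\sigma$ takes a word of extent $[-n,m]$ to one of extent $[-n-1,m-1]$). For a finite admissible word $w$ of extent $[-n,m]$, $R(w)=\overline{\bigcap_{k=-n}^{m}f^{-k}(\operatorname{int}R_{w_k})}$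 (images under iterates of $f^{\pm1}$; no point of $\operatorname{int}R_0\cup\operatorname{int}R_1$ is indeterminate for any iterate of $f$ or $f^{-1}$). If $w$ is infinite, $R(w)$ is the intersection of all $R(w')$ over the finite admissible subwords $w'$ of $w$ (with positions inherited from $w$). *)

theory Defs
  imports "HOL-Analysis.Analysis"
begin

section \<open>The compactified plane\<close>

text \<open>\<open>None\<close> is the point \<open>\<infinity>\<close>, both ends of the real line being identified to it.\<close>

definition rline :: "real option topology" where
  "rline = Alexandroff_compactification euclidean"

definition rplane :: "(real option \<times> real option) topology" where
  "rplane = prod_topology rline rline"


section \<open>The map, its inverse, and their continuous extensions\<close>

definition f_aff :: "real \<Rightarrow> real \<times> real \<Rightarrow> real \<times> real" where
  "f_aff a = (\<lambda>(x, y). (y * ((x + a) / (x - 1)), x + a - 1))"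

definition finv_aff :: "real \<Rightarrow> real \<times> real \<Rightarrow> real \<times> real" where
  "finv_aff a = (\<lambda>(x, y). (y + 1 - a, x * ((y - a) / (y + 1))))"

definition I_f :: "real \<Rightarrow> (real option \<times> real option) set" where
  "I_f a = {(Some 1, Some 0), (Some (- a), None)}"

definition I_finv :: "real \<Rightarrow> (real option \<times> real option) set" where
  "I_finv a = {(Some 0, Some (- 1)), (None, Some a)}"

text \<open>Multiplication with \<open>\<infinity> \<cdot> t = \<infinity>\<close> for \<open>t \<noteq> 0\<close>; the value at \<open>0 \<cdot> \<infinity>\<close> is meaningless,
  and such a product arises below exactly at the indeterminacy points.\<close>

fun pmul :: "real option \<Rightarrow> real option \<Rightarrow> real option" where
  "pmul (Some s) (Some t) = Some (s * t)"
| "pmul _ _ = None"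

text \<open>The extension of \<open>t \<mapsto> (t + p) / (t - q)\<close>, for \<open>p \<noteq> - q\<close>.\<close>

fun moeb :: "real \<Rightarrow> real \<Rightarrow> real option \<Rightarrow> real option" where
  "moeb p q None = Some 1"
| "moeb p q (Some t) = (if t = q then None else Some ((t + p) / (t - q)))"

text \<open>\<open>f_ext a\<close> and \<open>finv_ext a\<close> are the continuous extensions of \<open>f\<close> and \<open>f\<^sup>-\<^sup>1\<close>
  off the respective indeterminacy sets, see \<open>f_ext_is_extension\<close>, \<open>f_ext_unique\<close>,
  \<open>finv_ext_is_extension\<close> and \<open>finv_ext_unique\<close>.
  Their values on the indeterminacy sets are irrelevant: the orbits used below never meet these
  sets, see \<open>iterates_not_indeterminate\<close>.\<close>

definition f_ext :: "real \<Rightarrow> real option \<times> real option \<Rightarrow> real option \<times> real option" where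
  "f_ext a = (\<lambda>(x, y). (pmul y (moeb a 1 x), map_option (\<lambda>t. t + a - 1) x))"

definition finv_ext :: "real \<Rightarrow> real option \<times> real option \<Rightarrow> real option \<times> real option" where
  "finv_ext a = (\<lambda>(x, y). (map_option (\<lambda>t. t + 1 - a) y, pmul x (moeb (- a) (- 1) y)))"

definition f_image :: "real \<Rightarrow> (real option \<times> real option) set \<Rightarrow> (real option \<times> real option) set" where
  "f_image a S = rplane closure_of (f_ext a ` (S - I_f a))"

definition f_iter :: "real \<Rightarrow> int \<Rightarrow> real option \<times> real option \<Rightarrow> real option \<times> real option" where
  "f_iter a k = (if 0 \<le> k then f_ext a ^^ nat k else finv_ext a ^^ nat (- k))"


section \<open>Words and rectangles\<close>

definition rect :: "nat \<Rightarrow> (real option \<times> real option) set" where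
  "rect i = (if i = 0
     then insert None (Some ` {1..}) \<times> insert None (Some ` {..- 1})
     else insert None (Some ` {..0}) \<times> insert None (Some ` {0..}))"

definition Sigma01 :: "(int \<Rightarrow> nat) set" where
  "Sigma01 = {s. range s \<subseteq> {0, 1} \<and> (\<nexists>j. s j = 1 \<and> s (j + 1) = 1)}"

text \<open>The integer interval \<open>[-n, m]\<close>, where \<open>n\<close> and \<open>m\<close> may be infinite; note that \<open>nat\<close> sends
  negative integers to 0.\<close>

definition extent :: "enat \<Rightarrow> enat \<Rightarrow> int set" where
  "extent n m = {j. enat (nat (- j)) \<le> n \<and> enat (nat j) \<le> m}"

text \<open>A word is a partial map on the integers, whose domain is its extent.\<close>

definition admissible :: "(int \<rightharpoonup> nat) \<Rightarrow> bool" where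
  "admissible w \<longleftrightarrow> (\<exists>s\<in>Sigma01. \<exists>n m. w = (\<lambda>j. Some (s j)) |` extent n m)"

definition shift :: "(int \<rightharpoonup> nat) \<Rightarrow> (int \<rightharpoonup> nat)" where
  "shift w = (\<lambda>j. w (j + 1))"

definition R_fin :: "real \<Rightarrow> (int \<rightharpoonup> nat) \<Rightarrow> (real option \<times> real option) set" where
  "R_fin a w = rplane closure_of
     (\<Inter>k\<in>dom w. f_iter a (- k) ` (rplane interior_of rect (the (w k))))"

definition R :: "real \<Rightarrow> (int \<rightharpoonup> nat) \<Rightarrow> (real option \<times> real option) set" where
  "R a w = (if finite (dom w) then R_fin a w
     else (\<Inter>w'\<in>{w'. admissible w' \<and> finite (dom w') \<and> w' \<subseteq>\<^sub>m w}. R_fin a w'))"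


section \<open>The maps defined above are the continuous extensions\<close>

lemma topspace_rline [simp]: "topspace rline = UNIV"
  unfolding rline_def topspace_Alexandroff_compactification topspace_euclidean UNIV_option_conv ..

lemma topspace_rplane [simp]: "topspace rplane = UNIV"
  unfolding rplane_def topspace_prod_topology topspace_rline UNIV_Times_UNIV ..

lemma openin_rline_Some: "openin rline (Some ` U) \<longleftrightarrow> open U"
  unfolding rline_def openin_Alexandroff_compactification_image_Some by (rule open_openin[symmetric])

lemma openin_rline:
  "openin rline V \<longleftrightarrow> (\<exists>U. open U \<and> V = Some ` U) \<or> (\<exists>C. compact C \<and> V = insert None (Some ` (- C)))"
proof -
  have "(compactin euclidean C \<and> closedin euclidean C \<and> Q) = (compact C \<and> Q)" for C :: "real set" and Q
    using compact_imp_closed[of C] unfolding compactin_euclidean_iff closed_closedin[symmetric] by blast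
  then show ?thesis
    unfolding rline_def openin_Alexandroff_compactification Compl_eq_Diff_UNIV topspace_euclidean
      open_openin[symmetric] by (simp only:)
qed

lemma openin_rline_infty: "compact C \<Longrightarrow> openin rline (insert None (Some ` (- C)))"
  unfolding openin_rline by (rule disjI2, rule exI[where x = C]) simp

lemma Hausdorff_rline: "Hausdorff_space rline"
  unfolding rline_def Hausdorff_space_Alexandroff_compactification
  by (simp only: locally_compact_space_euclidean Hausdorff_space_euclidean simp_thms)

lemma Hausdorff_rplane: "Hausdorff_space rplane"
  unfolding rplane_def Hausdorff_space_prod_topology using Hausdorff_rline by blast

lemma openin_rline_neq: "openin rline (- {q})"
proof -
  have "closedin rline {q}"
    by (rule closedin_Hausdorff_singleton) (simp_all add: Hausdorff_rline)
  then have "openin rline (topspace rline - {q})"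
    by (simp only: closedin_def)
  then show ?thesis
    by (simp only: topspace_rline Compl_eq_Diff_UNIV)
qed

fun pinv :: "real option \<Rightarrow> real option" where
  "pinv None = Some 0"
| "pinv (Some t) = (if t = 0 then None else Some (inverse t))"

lemma continuous_map_rlineI:
  assumes "\<And>U. open U \<Longrightarrow> openin X {x \<in> topspace X. h x \<in> Some ` U}"
    and "\<And>C. compact C \<Longrightarrow> openin X {x \<in> topspace X. h x \<in> insert None (Some ` (- C))}"
  shows "continuous_map X rline h"
  unfolding continuous_map_def openin_rline using assms by auto

lemma continuous_map_pinv: "continuous_map rline rline pinv"
proof (rule continuous_map_rlineI)
  fix U :: "real set" assume U: "open U"
  define W where "W = {t. t \<noteq> 0 \<and> inverse t \<in> U}"
  have "W = (- {0}) \<inter> inverse -` U"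
    by (auto simp: W_def)
  moreover have "open ((- {0}) \<inter> inverse -` U)"
    by (intro continuous_open_preimage continuous_intros U) auto
  ultimately have W: "open W" by simp
  show "openin rline {x \<in> topspace rline. pinv x \<in> Some ` U}"
  proof (cases "0 \<in> U")
    case False
    have "{x \<in> topspace rline. pinv x \<in> Some ` U} = Some ` W"
      using False
      by (intro set_eqI, rename_tac x, case_tac x) (auto simp: W_def image_iff split: if_splits)
    then show ?thesis using W by (simp only: openin_rline_Some)
  next
    case True
    then obtain e where e: "e > 0" "ball 0 e \<subseteq> U"
      using U open_contains_ball by blast
    have "\<bar>t\<bar> \<le> inverse e" if "t \<in> - W" for t
    proof (cases "t = 0")
      case False
      then have "inverse t \<notin> ball 0 e" using that e(2) False unfolding W_def by blast
      then have "e \<le> \<bar>inverse t\<bar>" by (simp add: dist_real_def del: abs_inverse)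
      then have "e \<le> inverse \<bar>t\<bar>" by simp
      then show ?thesis using e
        by (metis le_imp_inverse_le inverse_inverse_eq)
    qed (use e in auto)
    then have "bounded (- W)" by (auto simp: bounded_iff)
    then have "compact (- W)" using W by (simp add: compact_eq_bounded_closed closed_def)
    moreover have "{x \<in> topspace rline. pinv x \<in> Some ` U} = insert None (Some ` (- (- W)))"
      using True
      by (intro set_eqI, rename_tac x, case_tac x) (auto simp: W_def image_iff split: if_splits)
    ultimately show ?thesis by (simp only: openin_rline_infty)
  qed
next
  fix C :: "real set" assume C: "compact C"
  obtain B where B: "B > 0" "\<And>t. t \<in> C \<Longrightarrow> \<bar>t\<bar> \<le> B"
    using compact_imp_bounded[OF C] unfolding bounded_pos by auto
  define K where "K = {t. t \<noteq> 0 \<and> inverse t \<in> C}"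
  have KB: "inverse B \<le> \<bar>t\<bar>" if "t \<in> K" for t
  proof -
    have "\<bar>inverse t\<bar> \<le> B" and "t \<noteq> 0" using that B(2) unfolding K_def by blast+
    then have "inverse \<bar>t\<bar> \<le> B" and "0 < inverse \<bar>t\<bar>" by auto
    then show ?thesis
      by (metis inverse_inverse_eq le_imp_inverse_le)
  qed
  have ne: "t \<noteq> 0" if "inverse B \<le> \<bar>t\<bar>" for t
    using that B(1) by (auto simp: field_simps)
  then have "K = {t. inverse B \<le> \<bar>t\<bar>} \<inter> inverse -` C"
    using KB by (auto simp: K_def)
  moreover have "closed ({t. inverse B \<le> \<bar>t\<bar>} \<inter> inverse -` C)"
    using ne
    by (intro continuous_closed_preimage continuous_intros closed_Collect_le compact_imp_closed C) auto
  ultimately have K: "closed K" by simp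
  show "openin rline {x \<in> topspace rline. pinv x \<in> insert None (Some ` (- C))}"
  proof (cases "0 \<in> C")
    case True
    have "{x \<in> topspace rline. pinv x \<in> insert None (Some ` (- C))} = Some ` (- K)"
      using True
      by (intro set_eqI, rename_tac x, case_tac x) (auto simp: K_def image_iff split: if_splits)
    then show ?thesis using open_Compl[OF K] by (simp only: openin_rline_Some)
  next
    case False
    then have "open (- C)" "0 \<in> - C" using C compact_imp_closed by auto
    then obtain e where e: "e > 0" "ball 0 e \<subseteq> - C"
      using open_contains_ball by blast
    have "\<bar>t\<bar> \<le> inverse e" if "t \<in> K" for t
    proof -
      have "inverse t \<notin> ball 0 e" using that e(2) unfolding K_def by blast
      then have "e \<le> \<bar>inverse t\<bar>" by (simp add: dist_real_def del: abs_inverse)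
      then have "e \<le> inverse \<bar>t\<bar>" by simp
      then show ?thesis using e
        by (metis le_imp_inverse_le inverse_inverse_eq)
    qed
    then have "bounded K" by (auto simp: bounded_iff)
    then have "compact K" using K by (simp add: compact_eq_bounded_closed)
    moreover have "{x \<in> topspace rline. pinv x \<in> insert None (Some ` (- C))} = insert None (Some ` (- K))"
      using False
      by (intro set_eqI, rename_tac x, case_tac x) (auto simp: K_def image_iff split: if_splits)
    ultimately show ?thesis by (simp only: openin_rline_infty)
  qed
qed

lemma continuous_map_padd: "continuous_map rline rline (map_option (\<lambda>t. t + c))"
proof (rule continuous_map_rlineI)
  fix U :: "real set" assume U: "open U"
  have "{x \<in> topspace rline. map_option (\<lambda>t. t + c) x \<in> Some ` U} = Some ` ((\<lambda>t. t + c) -` U)"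
    by (rule set_eqI, rename_tac x, case_tac x) (auto simp: image_iff)
  moreover have "open ((\<lambda>t. t + c) -` U)"
    by (intro open_vimage U continuous_intros)
  ultimately show "openin rline {x \<in> topspace rline. map_option (\<lambda>t. t + c) x \<in> Some ` U}"
    by (simp only: openin_rline_Some)
next
  fix C :: "real set" assume C: "compact C"
  have "{x \<in> topspace rline. map_option (\<lambda>t. t + c) x \<in> insert None (Some ` (- C))}
      = insert None (Some ` (- ((\<lambda>t. t - c) ` C)))"
    by (rule set_eqI, rename_tac x, case_tac x) (force simp: image_iff)+
  moreover have "compact ((\<lambda>t. t - c) ` C)"
    by (intro compact_continuous_image C continuous_intros)
  ultimately show "openin rline {x \<in> topspace rline. map_option (\<lambda>t. t + c) x \<in> insert None (Some ` (- C))}"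
    by (simp only: openin_rline_infty)
qed

lemma openin_range_Some: "openin rline (range Some)"
  unfolding openin_rline_Some by (rule open_UNIV)

lemma continuous_map_the: "continuous_map (subtopology rline (range Some)) euclideanreal the"
  unfolding continuous_map_def
proof (intro conjI allI impI)
  fix U :: "real set" assume "openin euclideanreal U"
  then have "openin rline (Some ` U)" by (simp add: openin_rline_Some)
  moreover have "{x \<in> topspace (subtopology rline (range Some)). the x \<in> U} = Some ` U"
    by auto
  ultimately show "openin (subtopology rline (range Some)) {x \<in> topspace (subtopology rline (range Some)). the x \<in> U}"
    by (simp only: openin_open_subtopology[OF openin_range_Some] image_mono[OF subset_UNIV] simp_thms)
qed simp

lemma continuous_map_rline_Some: "continuous_map euclideanreal rline Some"
  unfolding rline_def by (rule continuous_map_Some)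

lemma continuous_map_pmul_finite:
  "continuous_map (subtopology rplane (range Some \<times> range Some)) rline (\<lambda>p. pmul (fst p) (snd p))"
proof -
  let ?X = "subtopology rplane (range Some \<times> range Some)"
  have X: "?X = prod_topology (subtopology rline (range Some)) (subtopology rline (range Some))"
    by (simp add: rplane_def subtopology_Times)
  have "continuous_map ?X euclideanreal (the \<circ> fst)" "continuous_map ?X euclideanreal (the \<circ> snd)"
    unfolding X
    by (rule continuous_map_compose[OF continuous_map_fst continuous_map_the],
        rule continuous_map_compose[OF continuous_map_snd continuous_map_the])
  then have "continuous_map ?X euclideanreal (\<lambda>p. the (fst p) * the (snd p))"
    by (simp add: continuous_map_real_mult o_def)
  then have "continuous_map ?X rline (Some \<circ> (\<lambda>p. the (fst p) * the (snd p)))"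
    using continuous_map_compose continuous_map_rline_Some by blast
  then show ?thesis
    by (rule continuous_map_eq) auto
qed

lemma pmul_pinv: "p \<noteq> Some 0 \<Longrightarrow> q \<noteq> Some 0 \<Longrightarrow> pinv (pmul (pinv p) (pinv q)) = pmul p q"
  by (cases p; cases q) auto

lemma openin_rplane_Times: "openin rline S \<Longrightarrow> openin rline T \<Longrightarrow> openin rplane (S \<times> T)"
  by (simp add: rplane_def openin_prod_Times_iff)

lemma continuous_map_pmul:
  "continuous_map (subtopology rplane (- {(Some 0, None), (None, Some 0)})) rline (\<lambda>p. pmul (fst p) (snd p))"
proof -
  define D :: "(real option \<times> real option) set" where "D = - {(Some 0, None), (None, Some 0)}"
  define T :: "bool \<Rightarrow> (real option \<times> real option) set"
    where "T b = (if b then range Some \<times> range Some else (- {Some 0}) \<times> (- {Some 0}))" for b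
  have TD: "T b \<subseteq> D" for b by (auto simp: T_def D_def)
  have opT: "openin rplane (T b)" for b
    by (auto simp: T_def intro!: openin_rplane_Times openin_range_Some openin_rline_neq)
  have ct: "continuous_map (subtopology rplane (T b)) rline (\<lambda>p. pmul (fst p) (snd p))" for b
  proof (cases b)
    case True
    then show ?thesis using continuous_map_pmul_finite by (simp add: T_def)
  next
    case False
    have 1: "continuous_map rplane rline (pinv \<circ> fst)" "continuous_map rplane rline (pinv \<circ> snd)"
      unfolding rplane_def
      by (rule continuous_map_compose[OF continuous_map_fst continuous_map_pinv],
          rule continuous_map_compose[OF continuous_map_snd continuous_map_pinv])
    have "continuous_map rplane rplane (\<lambda>p. (pinv (fst p), pinv (snd p)))"
      unfolding rplane_def[of ] using 1 unfolding rplane_def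
      by (simp add: continuous_map_pairwise o_def)
    then have "continuous_map (subtopology rplane (T b)) (subtopology rplane (range Some \<times> range Some))
        (\<lambda>p. (pinv (fst p), pinv (snd p)))"
    proof (rule continuous_map_into_subtopology[OF continuous_map_from_subtopology])
      have "pinv p \<in> range Some" if "p \<noteq> Some 0" for p using that by (cases p) auto
      then show "(\<lambda>p. (pinv (fst p), pinv (snd p))) \<in> topspace (subtopology rplane (T b)) \<rightarrow> range Some \<times> range Some"
        using False by (auto simp: T_def)
    qed
    then have "continuous_map (subtopology rplane (T b)) rline
      (pinv \<circ> ((\<lambda>p. pmul (fst p) (snd p)) \<circ> (\<lambda>p. (pinv (fst p), pinv (snd p)))))"
      by (intro continuous_map_compose[OF _ continuous_map_pinv] continuous_map_compose[OF _ continuous_map_pmul_finite])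
    moreover have "(pinv \<circ> ((\<lambda>p. pmul (fst p) (snd p)) \<circ> (\<lambda>p. (pinv (fst p), pinv (snd p))))) p
        = pmul (fst p) (snd p)" if "p \<in> topspace (subtopology rplane (T b))" for p
    proof -
      have "fst p \<noteq> Some 0" "snd p \<noteq> Some 0" using that False by (auto simp: T_def)
      then show ?thesis by (simp add: pmul_pinv)
    qed
    ultimately show ?thesis
      by (rule continuous_map_eq)
  qed
  have "continuous_map (subtopology rplane D) rline (\<lambda>p. pmul (fst p) (snd p))"
  proof (rule pasting_lemma[where I = UNIV and T = T and f = "\<lambda>_ p. pmul (fst p) (snd p)"])
    show "openin (subtopology rplane D) (T b)" for b
      using opT TD by (simp add: subset_openin_subtopology)
    show "continuous_map (subtopology (subtopology rplane D) (T b)) rline (\<lambda>p. pmul (fst p) (snd p))" for b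
      using ct TD by (simp add: subtopology_subtopology Int_absorb1)
    show "\<exists>j. j \<in> UNIV \<and> x \<in> T j \<and> pmul (fst x) (snd x) = pmul (fst x) (snd x)"
      if "x \<in> topspace (subtopology rplane D)" for x
    proof -
      obtain p q where x: "x = (p, q)" by force
      have "x \<in> T True \<or> x \<in> T False"
        using that by (cases p; cases q) (auto simp: T_def D_def x)
      then show ?thesis by auto
    qed
  qed auto
  then show ?thesis by (simp add: D_def)
qed

lemma continuous_map_pmul_const:
  assumes "c \<noteq> 0"
  shows "continuous_map rline rline (pmul (Some c))"
proof -
  have "continuous_map rline rplane (\<lambda>t. (Some c, t))"
    by (simp add: rplane_def continuous_map_pairwise o_def)
  then have "continuous_map rline (subtopology rplane (- {(Some 0, None), (None, Some 0)})) (\<lambda>t. (Some c, t))"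
    by (rule continuous_map_into_subtopology) (use assms in auto)
  from continuous_map_compose[OF this continuous_map_pmul] show ?thesis
    by (simp add: o_def)
qed

lemma continuous_map_moeb:
  assumes "p \<noteq> - q"
  shows "continuous_map rline rline (moeb p q)"
proof -
  have "continuous_map rline rline (map_option (\<lambda>t. t + 1) \<circ> (pmul (Some (p + q)) \<circ>
      (pinv \<circ> map_option (\<lambda>t. t + (- q)))))"
    using assms
    by (intro continuous_map_compose[OF _ continuous_map_padd] continuous_map_compose[OF _ continuous_map_pinv]
         continuous_map_compose[OF _ continuous_map_pmul_const] continuous_map_padd) auto
  moreover have "(map_option (\<lambda>t. t + 1) \<circ> (pmul (Some (p + q)) \<circ> (pinv \<circ> map_option (\<lambda>t. t + (- q))))) t
      = moeb p q t" for t
    by (cases t) (auto simp: field_simps)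
  ultimately show ?thesis
    by (metis (mono_tags, lifting) continuous_map_eq)
qed

lemma moeb_eq_None: "p \<noteq> - q \<Longrightarrow> moeb p q t = None \<longleftrightarrow> t = Some q"
  by (cases t) auto

lemma moeb_eq_0: "p \<noteq> - q \<Longrightarrow> moeb p q t = Some 0 \<longleftrightarrow> t = Some (- p)"
  by (cases t) (auto simp: add_eq_0_iff2)

lemma continuous_map_pmul_comp:
  assumes g: "continuous_map X rline g" and h: "continuous_map X rline h"
    and ne: "\<And>x. x \<in> topspace X \<Longrightarrow> (g x, h x) \<notin> {(Some 0, None), (None, Some 0)}"
  shows "continuous_map X rline (\<lambda>x. pmul (g x) (h x))"
proof -
  have "continuous_map X rplane (\<lambda>x. (g x, h x))"
    using g h by (simp add: rplane_def continuous_map_pairwise o_def)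
  then have "continuous_map X (subtopology rplane (- {(Some 0, None), (None, Some 0)})) (\<lambda>x. (g x, h x))"
    by (rule continuous_map_into_subtopology) (use ne in auto)
  from continuous_map_compose[OF this continuous_map_pmul] show ?thesis
    by (simp add: o_def)
qed

lemma continuous_map_rplane_fst: "continuous_map (subtopology rplane S) rline fst"
  and continuous_map_rplane_snd: "continuous_map (subtopology rplane S) rline snd"
  by (simp_all add: rplane_def continuous_map_from_subtopology continuous_map_fst continuous_map_snd)

theorem f_ext_is_extension:
  assumes "a < -1"
  shows "continuous_map (subtopology rplane (- I_f a)) rplane (f_ext a)"
    and "\<And>x y. x \<noteq> 1 \<Longrightarrow> f_ext a (Some x, Some y) = map_prod Some Some (f_aff a (x, y))"
proof -
  let ?X = "subtopology rplane (- I_f a)"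
  have m: "continuous_map ?X rline (moeb a 1 \<circ> fst)"
    using assms by (intro continuous_map_compose[OF continuous_map_rplane_fst] continuous_map_moeb) auto
  have "continuous_map ?X rline (\<lambda>p. pmul (snd p) ((moeb a 1 \<circ> fst) p))"
    by (rule continuous_map_pmul_comp[OF continuous_map_rplane_snd m])
       (use assms in \<open>auto simp: I_f_def moeb_eq_None moeb_eq_0\<close>)
  moreover have "continuous_map ?X rline (map_option (\<lambda>t. t + (a - 1)) \<circ> fst)"
    by (intro continuous_map_compose[OF continuous_map_rplane_fst] continuous_map_padd)
  ultimately show "continuous_map ?X rplane (f_ext a)"
    unfolding rplane_def[symmetric] f_ext_def
    by (simp add: rplane_def continuous_map_pairwise o_def case_prod_unfold add_diff_eq)
qed (simp add: f_ext_def f_aff_def)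

theorem finv_ext_is_extension:
  assumes "a < -1"
  shows "continuous_map (subtopology rplane (- I_finv a)) rplane (finv_ext a)"
    and "\<And>x y. y \<noteq> -1 \<Longrightarrow> finv_ext a (Some x, Some y) = map_prod Some Some (finv_aff a (x, y))"
proof -
  let ?X = "subtopology rplane (- I_finv a)"
  have m: "continuous_map ?X rline (moeb (- a) (- 1) \<circ> snd)"
    using assms by (intro continuous_map_compose[OF continuous_map_rplane_snd] continuous_map_moeb) auto
  have "continuous_map ?X rline (\<lambda>p. pmul (fst p) ((moeb (- a) (- 1) \<circ> snd) p))"
    by (rule continuous_map_pmul_comp[OF continuous_map_rplane_fst m])
       (use assms in \<open>auto simp: I_finv_def moeb_eq_None moeb_eq_0\<close>)
  moreover have "continuous_map ?X rline (map_option (\<lambda>t. t + (1 - a)) \<circ> snd)"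
    by (intro continuous_map_compose[OF continuous_map_rplane_snd] continuous_map_padd)
  ultimately show "continuous_map ?X rplane (finv_ext a)"
    unfolding finv_ext_def
    by (simp add: rplane_def continuous_map_pairwise o_def case_prod_unfold add_diff_eq)
qed (simp add: finv_ext_def finv_aff_def)

lemma rline_dense: "rline closure_of (Some ` (- {c})) = UNIV"
proof -
  have "p \<in> rline closure_of (Some ` (- {c}))" for p
    unfolding in_closure_of
  proof (intro conjI allI impI)
    fix T assume T: "p \<in> T \<and> openin rline T"
    then consider U where "open U" "T = Some ` U" "U \<noteq> {}" | C where "compact C" "T = insert None (Some ` (- C))"
      unfolding openin_rline by auto
    then show "\<exists>y. y \<in> Some ` (- {c}) \<and> y \<in> T"
    proof cases
      case 1
      then have "\<not> U \<subseteq> {c}"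
        by (metis finite.emptyI finite_insert finite_subset not_open_singleton subset_singletonD)
      then show ?thesis using 1 by auto
    next
      case 2
      then have "\<not> - C \<subseteq> {c}"
        by (metis Compl_subset_Compl_iff bounded_Un bounded_insert bounded_empty compact_imp_bounded
            double_complement not_bounded_UNIV Un_commute Compl_partition bounded_subset)
      then show ?thesis using 2 by auto
    qed
  qed auto
  then show ?thesis by auto
qed

lemma dense_ext_unique:
  assumes "continuous_map (subtopology rplane S) rplane g" "continuous_map (subtopology rplane S) rplane h"
    and S: "openin rplane S" and "p \<in> S"
    and "\<And>x y. x \<noteq> c \<Longrightarrow> y \<noteq> d \<Longrightarrow> g (Some x, Some y) = h (Some x, Some y)"
  shows "g p = h p"
proof (rule forall_in_closure_of_eq[OF _ Hausdorff_rplane assms(1,2)])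
  let ?D = "Some ` (- {c}) \<times> Some ` (- {d})"
  have "rplane closure_of ?D = UNIV"
    by (simp add: rplane_def closure_of_Times rline_dense)
  then have "p \<in> rplane closure_of ?D" by (simp only: UNIV_I)
  then have "\<exists>y. y \<in> S \<inter> ?D \<and> y \<in> T" if "p \<in> T" "openin rplane T" "T \<subseteq> S" for T
    using that unfolding in_closure_of by blast
  then show "p \<in> subtopology rplane S closure_of (S \<inter> ?D)"
    unfolding in_closure_of openin_open_subtopology[OF S] using \<open>p \<in> S\<close> by simp
qed (use assms(5) in auto)

lemma openin_Compl_pair: "openin rplane (- {p, q})"
proof -
  have "closedin rplane {p, q}"
    by (rule closedin_Hausdorff_finite) (auto simp: Hausdorff_rplane)
  then have "openin rplane (topspace rplane - {p, q})"
    by (simp only: closedin_def)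
  then show ?thesis
    by (simp only: topspace_rplane Compl_eq_Diff_UNIV)
qed

theorem f_ext_unique:
  assumes "a < -1" and g: "continuous_map (subtopology rplane (- I_f a)) rplane g"
    and "\<And>x y. x \<noteq> 1 \<Longrightarrow> g (Some x, Some y) = map_prod Some Some (f_aff a (x, y))"
    and "p \<notin> I_f a"
  shows "g p = f_ext a p"
  by (rule dense_ext_unique[OF g f_ext_is_extension(1)[OF assms(1)], where c = 1 and d = 0])
     (use assms f_ext_is_extension(2)[OF assms(1)] in \<open>auto simp: I_f_def openin_Compl_pair\<close>)

theorem finv_ext_unique:
  assumes "a < -1" and g: "continuous_map (subtopology rplane (- I_finv a)) rplane g"
    and "\<And>x y. y \<noteq> -1 \<Longrightarrow> g (Some x, Some y) = map_prod Some Some (finv_aff a (x, y))"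
    and "p \<notin> I_finv a"
  shows "g p = finv_ext a p"
  by (rule dense_ext_unique[OF g finv_ext_is_extension(1)[OF assms(1)], where c = 0 and d = "-1"])
     (use assms finv_ext_is_extension(2)[OF assms(1)] in \<open>auto simp: I_finv_def openin_Compl_pair\<close>)


section \<open>Iterates do not meet the indeterminacy sets\<close>

lemma interior_of_infty_Some:
  assumes "\<not> bounded (- A)"
  shows "rline interior_of (insert None (Some ` A)) = Some ` interior A"
proof
  show "Some ` interior A \<subseteq> rline interior_of (insert None (Some ` A))"
    using interior_subset[of A]
    by (intro interior_of_maximal) (auto simp: openin_rline_Some)
  show "rline interior_of (insert None (Some ` A)) \<subseteq> Some ` interior A"
  proof
    fix p assume "p \<in> rline interior_of (insert None (Some ` A))"
    then obtain T where T: "openin rline T" "p \<in> T" "T \<subseteq> insert None (Some ` A)"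
      unfolding interior_of_def by blast
    from T(1) consider U where "open U" "T = Some ` U"
      | C where "compact C" "T = insert None (Some ` (- C))"
      unfolding openin_rline by blast
    then show "p \<in> Some ` interior A"
    proof cases
      case 1
      then have "U \<subseteq> A" using T(3) by auto
      then show ?thesis using 1 T(2) interior_maximal[of U A] by auto
    next
      case 2
      then have "- A \<subseteq> C" using T(3) by auto
      then show ?thesis
        using assms 2 compact_imp_bounded bounded_subset by blast
    qed
  qed
qed

lemma interior_of_rect:
  "rplane interior_of rect i
     = (if i = 0 then Some ` {1<..} \<times> Some ` {..<- 1} else Some ` {..<0} \<times> Some ` {0<..})"
proof -
  have 1: "\<not> bounded (- {c..})" "\<not> bounded (- {..c})" for c :: real
  proof -
    have "- {c..} = {..<c}" "- {..c} = {c<..}" by auto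
    moreover have "\<not> bdd_below {..<c}"
    proof
      assume "bdd_below {..<c}"
      then obtain m where "\<forall>x\<in>{..<c}. m \<le> x" unfolding bdd_below_def by blast
      moreover have "min c m - 1 \<in> {..<c}" "\<not> m \<le> min c m - 1" by auto
      ultimately show False by blast
    qed
    moreover have "\<not> bdd_above {c<..}"
    proof
      assume "bdd_above {c<..}"
      then obtain m where "\<forall>x\<in>{c<..}. x \<le> m" unfolding bdd_above_def by blast
      moreover have "max c m + 1 \<in> {c<..}" "\<not> max c m + 1 \<le> m" by auto
      ultimately show False by blast
    qed
    ultimately show "\<not> bounded (- {c..})" "\<not> bounded (- {..c})"
      using bounded_imp_bdd_below[of "{..<c}"] bounded_imp_bdd_above[of "{c<..}"] by auto
  qed
  show ?thesis
    unfolding rect_def rplane_def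
    by (cases "i = 0") (simp_all only: if_True if_False simp_thms interior_of_Times interior_of_infty_Some[OF 1(1)]
        interior_of_infty_Some[OF 1(2)] interior_real_atLeast interior_real_atMost)
qed

theorem iterates_not_indeterminate:
  assumes "a < -1" and p: "p \<in> rplane interior_of rect 0 \<union> rplane interior_of rect 1"
  shows "(f_ext a ^^ n) p \<notin> I_f a" and "(finv_ext a ^^ n) p \<notin> I_finv a"
proof -
  let ?Q = "insert None (Some ` {1..}) \<times> insert None (Some ` {0..}) :: (real option \<times> real option) set"
  let ?Q' = "insert None (Some ` {..0}) \<times> insert None (Some ` {..- 1}) :: (real option \<times> real option) set"
  have 1: "f_ext a q \<notin> ?Q" if nq: "q \<notin> ?Q" for q
  proof -
    obtain x y where q: "q = (x, y)" by force
    show ?thesis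
    proof (cases x)
      case None
      then show ?thesis using nq by (cases y) (auto simp: q f_ext_def)
    next
      case (Some s)
      show ?thesis
      proof (cases "s + a - 1 \<ge> 0")
        case True
        then obtain t where t: "y = Some t" "t < 0"
          using nq Some assms(1) by (cases y) (auto simp: q image_iff)
        have "t * ((s + a) / (s - 1)) \<le> 0"
          using True assms(1) t by (intro mult_nonpos_nonneg divide_nonneg_nonneg) auto
        then show ?thesis using Some t True assms(1) by (auto simp: q f_ext_def)
      qed (use Some in \<open>auto simp: q f_ext_def\<close>)
    qed
  qed
  have 2: "finv_ext a q \<notin> ?Q'" if nq: "q \<notin> ?Q'" for q
  proof -
    obtain x y where q: "q = (x, y)" by force
    show ?thesis
    proof (cases y)
      case None
      then show ?thesis using nq by (cases x) (auto simp: q finv_ext_def)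
    next
      case (Some s)
      show ?thesis
      proof (cases "s + 1 - a \<le> 0")
        case True
        then obtain t where t: "x = Some t" "t > 0"
          using nq Some assms(1) by (cases x) (auto simp: q image_iff)
        have "t * ((s - a) / (s + 1)) \<ge> 0"
          using True assms(1) t by (intro mult_nonneg_nonneg divide_nonpos_nonpos) auto
        then show ?thesis using Some t True assms(1) by (auto simp: q finv_ext_def)
      qed (use Some in \<open>auto simp: q finv_ext_def\<close>)
    qed
  qed
  have p': "p \<notin> ?Q" "p \<notin> ?Q'" using p by (auto simp: interior_of_rect)
  have "(f_ext a ^^ n) p \<notin> ?Q" by (induction n) (use p' 1 in auto)
  then show "(f_ext a ^^ n) p \<notin> I_f a" using assms(1) by (auto simp: I_f_def)
  have "(finv_ext a ^^ n) p \<notin> ?Q'" by (induction n) (use p' 2 in auto)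
  then show "(finv_ext a ^^ n) p \<notin> I_finv a" using assms(1) by (auto simp: I_finv_def)
qed

end

theory Submission
  imports Defs
begin

text \<open>
  The intersection of open pieces that defines \<open>R(w)\<close> is carried by \<open>f\<close> exactly onto the one that
  defines \<open>R(\<sigma>w)\<close>. The maps \<open>f\<close> and \<open>f\<^sup>-\<^sup>1\<close> are not injective on the compactified plane, as each of
  them collapses two lines to points; but the values on these lines have a coordinate \<open>0\<close> or \<open>\<infinity>\<close>,
  so the two maps undo each other wherever the value has finite nonzero coordinates. The points of
  the open rectangles have such coordinates, and admissibility of \<open>w\<close> and \<open>\<sigma>w\<close>
  gives \<open>w\<close> letters at the positions \<open>0\<close> and \<open>1\<close>, so both intersections lie in an open rectangle.
  This is \<open>f_ext_image_INT\<close>.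

  For a finite word, continuity of \<open>f\<close> off its indeterminacy set lets one pass to closures
  (\<open>R_fin_shift\<close>). An infinite word is exhausted by its central truncations, whose sets decrease to
  \<open>R(w)\<close>; the same holds for \<open>\<sigma>w\<close> and the shifted truncations (\<open>R_eq_INT_exhaustion\<close>). It remains to
  see that the image of the decreasing intersection is the intersection of the images. This is a
  compactness argument, and it needs \<open>f\<close> to be defined on one of the sets: the point \<open>(1, 0)\<close> has
  a neighbourhood disjoint from both open rectangles, and \<open>(-a, \<infinity>)\<close> lies outside \<open>R(w)\<close>, hence outside
  some truncation's set.
\<close>

section \<open>The two maps on the open pieces\<close>

definition finite_nonzero :: "(real option \<times> real option) set" where
  "finite_nonzero = Some ` (- {0}) \<times> Some ` (- {0})"

lemma interior_rect_subset: "rplane interior_of rect i \<subseteq> finite_nonzero"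
  unfolding interior_of_rect finite_nonzero_def
  by (split if_split) (intro conjI impI Sigma_mono image_mono; force)

text \<open>The line \<open>x = -a\<close> goes to first coordinate \<open>0\<close>, the lines \<open>x = 1\<close>, \<open>x = \<infinity>\<close> and \<open>y = \<infinity>\<close> to points
  with an infinite coordinate. Off these lines, \<open>f\<close> is given by its affine formula and can be
  inverted.\<close>

lemma finv_ext_f_ext:
  assumes "f_ext a q \<in> finite_nonzero"
  shows "finv_ext a (f_ext a q) = q"
proof -
  obtain x y where q: "q = (Some x, y)" and x: "x \<noteq> 1"
    using assms by (cases q; cases "fst q"; cases "snd q")
      (auto simp: f_ext_def finite_nonzero_def split: if_splits)
  moreover obtain t where "y = Some t" and "x + a \<noteq> 0"
    using assms q x by (cases y) (auto simp: f_ext_def finite_nonzero_def)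
  moreover from this have "t * ((x + a) / (x - 1)) * ((x - 1) / (x + a)) = t"
    by (simp add: x)
  ultimately show ?thesis
    by (auto simp: f_ext_def finv_ext_def)
qed

lemma f_ext_finv_ext:
  assumes "finv_ext a q \<in> finite_nonzero"
  shows "f_ext a (finv_ext a q) = q"
proof -
  obtain x y where q: "q = (x, Some y)" and y: "y \<noteq> -1"
    using assms by (cases q; cases "fst q"; cases "snd q")
      (auto simp: finv_ext_def finite_nonzero_def split: if_splits)
  moreover obtain t where "x = Some t" and "y - a \<noteq> 0"
    using assms q y by (cases x) (auto simp: finv_ext_def finite_nonzero_def)
  moreover from this have "t * ((y - a) / (y + 1)) * ((y + 1) / (y - a)) = t"
    using y by (simp add: add_eq_0_iff2)
  ultimately show ?thesis
    by (auto simp: f_ext_def finv_ext_def)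
qed

lemma f_iter_forward_step: "k \<le> 0 \<Longrightarrow> f_iter a (1 - k) ` U = f_ext a ` f_iter a (- k) ` U"
proof -
  assume "k \<le> 0"
  then have "nat (1 - k) = Suc (nat (- k))" by simp
  then show ?thesis using \<open>k \<le> 0\<close> by (simp add: f_iter_def image_comp)
qed

lemma f_iter_backward_step: "1 \<le> k \<Longrightarrow> f_iter a (- k) ` U = finv_ext a ` f_iter a (1 - k) ` U"
proof -
  assume k: "1 \<le> k"
  show ?thesis
  proof (cases "k = 1")
    case True
    then show ?thesis by (simp add: f_iter_def image_comp)
  next
    case False
    then have "nat k = Suc (nat (k - 1))" using k by simp
    then show ?thesis using k False by (simp add: f_iter_def image_comp)
  qed
qed

text \<open>A condition at a time \<open>k \<ge> 1\<close> is a backward image and one at a time \<open>k \<le> 0\<close> a forward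
  image, so a point and its image correspond to each other through \<open>f\<^sup>-\<^sup>1\<close> in the first case and
  through \<open>f\<close> in the second. The conditions at times \<open>0\<close> and \<open>1\<close> make the point and its image
  finite and nonzero, so that the correspondence is one-to-one.\<close>

lemma f_ext_image_INT:
  assumes "0 \<in> D" "1 \<in> D" and U: "\<And>k. k \<in> D \<Longrightarrow> U k \<subseteq> finite_nonzero"
  shows "f_ext a ` (\<Inter>k\<in>D. f_iter a (- k) ` U k) = (\<Inter>k\<in>D. f_iter a (1 - k) ` U k)"
    (is "f_ext a ` (\<Inter>k\<in>D. ?A k) = (\<Inter>k\<in>D. ?B k)")
proof (intro equalityI subsetI)
  fix q assume "q \<in> f_ext a ` (\<Inter>k\<in>D. ?A k)"
  then obtain p where p: "\<And>k. k \<in> D \<Longrightarrow> p \<in> ?A k" and q: "q = f_ext a p" by blast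
  have "p \<in> U 0" using p[OF \<open>0 \<in> D\<close>] by (simp add: f_iter_def)
  then have p0: "p \<in> finite_nonzero" using U \<open>0 \<in> D\<close> by blast
  have "q \<in> ?B k" if k: "k \<in> D" for k
  proof (cases "1 \<le> k")
    case True
    then obtain r where "r \<in> ?B k" "p = finv_ext a r"
      using p[OF k] unfolding f_iter_backward_step[OF True] by blast
    then show ?thesis using f_ext_finv_ext p0 q by metis
  next
    case False
    then have "k \<le> 0" by simp
    then show ?thesis unfolding f_iter_forward_step[OF \<open>k \<le> 0\<close>] q by (intro imageI p k)
  qed
  then show "q \<in> (\<Inter>k\<in>D. ?B k)" by blast
next
  fix q assume "q \<in> (\<Inter>k\<in>D. ?B k)"
  then have q: "\<And>k. k \<in> D \<Longrightarrow> q \<in> ?B k" by blast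
  have "q \<in> U 1" using q[OF \<open>1 \<in> D\<close>] by (simp add: f_iter_def)
  then have q1: "q \<in> finite_nonzero" using U \<open>1 \<in> D\<close> by blast
  have preimage: "finv_ext a q \<in> ?A k \<and> f_ext a (finv_ext a q) = q" if "k \<in> D" "k \<le> 0" for k
  proof -
    obtain p where "p \<in> ?A k" "q = f_ext a p"
      using q[OF \<open>k \<in> D\<close>] unfolding f_iter_forward_step[OF \<open>k \<le> 0\<close>] by blast
    then show ?thesis using finv_ext_f_ext q1 by metis
  qed
  have "finv_ext a q \<in> ?A k" if "k \<in> D" for k
  proof (cases "1 \<le> k")
    case True
    then show ?thesis unfolding f_iter_backward_step[OF True] by (intro imageI q that)
  qed (use preimage \<open>k \<in> D\<close> in simp)
  moreover have "q = f_ext a (finv_ext a q)" using preimage[OF \<open>0 \<in> D\<close>] by simp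
  ultimately show "q \<in> f_ext a ` (\<Inter>k\<in>D. ?A k)" by blast
qed


section \<open>Finite words\<close>

lemma R_fin_mono: "w' \<subseteq>\<^sub>m w \<Longrightarrow> R_fin a w \<subseteq> R_fin a w'"
  unfolding R_fin_def
  by (intro closure_of_mono INF_superset_mono map_le_implies_dom_le)
     (auto simp: map_le_def)

lemma closedin_R_fin: "closedin rplane (R_fin a w)"
  by (simp add: R_fin_def)

lemma f_image_mono: "S \<subseteq> T \<Longrightarrow> f_image a S \<subseteq> f_image a T"
  unfolding f_image_def by (intro closure_of_mono) auto

lemma f_image_closure:
  assumes "a < -1" and "S \<inter> I_f a = {}"
  shows "f_image a (rplane closure_of S) = rplane closure_of (f_ext a ` S)"
proof
  have "subtopology rplane (- I_f a) closure_of S = - I_f a \<inter> rplane closure_of S"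
    using assms(2) by (intro closure_of_subtopology_open) auto
  then have "f_ext a ` (rplane closure_of S - I_f a) \<subseteq> rplane closure_of (f_ext a ` S)"
    using continuous_map_image_closure_subset[OF f_ext_is_extension(1)[OF assms(1)], of S]
    by (simp add: Diff_eq Int_commute)
  then show "f_image a (rplane closure_of S) \<subseteq> rplane closure_of (f_ext a ` S)"
    unfolding f_image_def by (rule closure_of_minimal) simp
  have "S \<subseteq> rplane closure_of S" by (rule closure_of_subset) simp
  then show "rplane closure_of (f_ext a ` S) \<subseteq> f_image a (rplane closure_of S)"
    unfolding f_image_def using assms(2) by (intro closure_of_mono) auto
qed

lemma R_fin_shift:
  assumes "a < -1" and "0 \<in> dom w" "1 \<in> dom w"
  shows "R_fin a (shift w) = f_image a (R_fin a w)"
proof -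
  define U where "U k = rplane interior_of rect (the (w k))" for k
  define P where "P = (\<Inter>k\<in>dom w. f_iter a (- k) ` U k)"
  have "dom (shift w) = (\<lambda>k. k - 1) ` dom w"
    by (force simp: shift_def dom_def image_iff)
  then have "(\<Inter>k\<in>dom (shift w). f_iter a (- k) ` (rplane interior_of rect (the (shift w k))))
      = (\<Inter>k\<in>dom w. f_iter a (1 - k) ` U k)"
    by (simp add: shift_def image_image U_def)
  also have "\<dots> = f_ext a ` P"
    unfolding P_def U_def
    by (rule f_ext_image_INT[OF assms(2,3) interior_rect_subset, symmetric])
  finally have "R_fin a (shift w) = rplane closure_of (f_ext a ` P)"
    unfolding R_fin_def by (rule arg_cong)
  moreover have "P \<subseteq> U 0"
    using INT_lower[OF assms(2), of "\<lambda>k. f_iter a (- k) ` U k"] by (simp add: f_iter_def P_def)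
  then have "P \<subseteq> finite_nonzero"
    using interior_rect_subset unfolding U_def by (rule subset_trans)
  then have "P \<inter> I_f a = {}" by (auto simp: finite_nonzero_def I_f_def)
  moreover have "R_fin a w = rplane closure_of P"
    by (simp only: R_fin_def P_def U_def)
  ultimately show ?thesis
    using f_image_closure[OF assms(1)] by (simp only:)
qed

text \<open>The quadrant \<open>x > 0\<close>, \<open>y > -1\<close> separates the point from both rectangles.\<close>

lemma indeterminate_1_0_notin_R_fin:
  assumes "0 \<in> dom w"
  shows "(Some 1, Some 0) \<notin> R_fin a w"
proof -
  define U where "U = rplane interior_of rect (the (w 0))"
  define V :: "(real option \<times> real option) set" where "V = Some ` {0<..} \<times> Some ` {-1<..}"
  define P where "P = (\<Inter>k\<in>dom w. f_iter a (- k) ` (rplane interior_of rect (the (w k))))"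
  have "openin rplane V"
    by (simp add: V_def rplane_def openin_prod_Times_iff openin_rline_Some)
  moreover have "(Some 1, Some 0) \<in> V" by (simp add: V_def)
  moreover have "P \<subseteq> U"
    using INT_lower[OF assms, of "\<lambda>k. f_iter a (- k) ` (rplane interior_of rect (the (w k)))"]
    by (simp add: f_iter_def P_def U_def)
  moreover have "U \<inter> V = {}"
    by (auto simp: U_def V_def interior_of_rect)
  ultimately show ?thesis
    unfolding R_fin_def P_def[symmetric] in_closure_of by blast
qed


section \<open>Truncations of infinite words\<close>

lemma admissible_zero_in_dom: "admissible w \<Longrightarrow> 0 \<in> dom w"
  by (auto simp: admissible_def extent_def zero_enat_def[symmetric])

lemma admissible_restrict:
  assumes "admissible w"
  shows "admissible (w |` {- int n..int m})"
proof -
  obtain s n' m' where s: "s \<in> Sigma01" and w: "w = (\<lambda>j. Some (s j)) |` extent n' m'"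
    using assms unfolding admissible_def by blast
  have "extent n' m' \<inter> {- int n..int m} = extent (min n' (enat n)) (min m' (enat m))"
    by (auto simp: extent_def)
  then have "w |` {- int n..int m} = (\<lambda>j. Some (s j)) |` extent (min n' (enat n)) (min m' (enat m))"
    by (simp add: w)
  then show ?thesis using s unfolding admissible_def by blast
qed

lemma shift_restrict: "shift (w |` {i..j}) = shift w |` {i - 1..j - 1}"
  by (auto simp: shift_def restrict_map_def)

lemma finite_dom_shift: "finite (dom (shift w)) \<longleftrightarrow> finite (dom w)"
proof -
  have "bij_betw (\<lambda>k. k - 1) (dom w) (dom (shift w))"
    by (rule bij_betw_byWitness[where f' = "\<lambda>k. k + 1"]) (auto simp: shift_def)
  then show ?thesis using bij_betw_finite by blast
qed

lemma finite_int_subset_symmetric: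
  fixes A :: "int set"
  assumes "finite A"
  obtains n where "A \<subseteq> {- int n..int n}"
proof -
  obtain k where "abs ` A \<subseteq> {..k}"
    using assms finite_int_iff_bounded_le by blast
  then have "\<bar>i\<bar> \<le> int (nat k)" if "i \<in> A" for i
    using that by fastforce
  then have "A \<subseteq> {- int (nat k)..int (nat k)}"
    by (meson abs_le_iff atLeastAtMost_iff minus_le_iff subsetI)
  then show ?thesis by (rule that)
qed

text \<open>A sequence of finite subwords that eventually covers every finite set of positions is cofinal
  among all finite subwords.\<close>

lemma R_eq_INT_exhaustion:
  assumes inf: "infinite (dom w)"
    and v: "\<And>n::nat. admissible (v n)" "\<And>n. finite (dom (v n))" "\<And>n. v n \<subseteq>\<^sub>m w"
    and cover: "\<And>A. finite A \<Longrightarrow> A \<subseteq> dom w \<Longrightarrow> \<exists>n. A \<subseteq> dom (v n)"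
  shows "R a w = (\<Inter>n. R_fin a (v n))"
proof -
  have "(\<Inter>n. R_fin a (v n)) \<subseteq> R_fin a w'" if w': "finite (dom w')" "w' \<subseteq>\<^sub>m w" for w'
  proof -
    obtain n where n: "dom w' \<subseteq> dom (v n)"
      using cover[OF w'(1) map_le_implies_dom_le[OF w'(2)]] by blast
    have "w' \<subseteq>\<^sub>m v n"
      using n w'(2) v(3)[of n] unfolding map_le_def by (metis subsetD)
    then show ?thesis using R_fin_mono by blast
  qed
  moreover have "R a w \<subseteq> R_fin a (v n)" for n
    using v inf unfolding R_def by auto
  ultimately show ?thesis
    using inf unfolding R_def by auto
qed


section \<open>Images of decreasing intersections\<close>

text \<open>A value attained on every \<open>K n\<close> has nonempty closed fibres in the sets \<open>K n\<close>, which
  decrease; a point common to all the fibres exists by compactness.\<close>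

lemma image_INT_decseq_compact:
  fixes K :: "nat \<Rightarrow> 'a set"
  assumes X: "compact_space X" and Y: "Hausdorff_space Y" and g: "continuous_map X Y g"
    and K: "\<And>n. closedin X (K n)" "decseq K"
  shows "g ` (\<Inter>n. K n) = (\<Inter>n. g ` K n)"
proof (intro equalityI subsetI)
  fix q assume q: "q \<in> (\<Inter>n. g ` K n)"
  have KX: "K n \<subseteq> topspace X" for n using K(1) by (rule closedin_subset)
  have "q \<in> topspace Y"
    using q KX[of 0] continuous_map_image_subset_topspace[OF g] by blast
  then have "closedin X {x \<in> topspace X. g x \<in> {q}}"
    by (intro closedin_continuous_map_preimage[OF g] closedin_Hausdorff_singleton[OF Y])
  then have "closedin X (K n \<inter> {x \<in> topspace X. g x \<in> {q}})" for n
    using K(1) by (rule closedin_Int[rotated])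
  moreover have "K n \<inter> {x \<in> topspace X. g x \<in> {q}} \<noteq> {}" for n
    using q KX[of n] by blast
  moreover have "decseq (\<lambda>n. K n \<inter> {x \<in> topspace X. g x \<in> {q}})"
    using K(2) by (auto simp: decseq_def)
  ultimately have "(\<Inter>n. K n \<inter> {x \<in> topspace X. g x \<in> {q}}) \<noteq> {}"
    using X by (intro compact_space_imp_nest)
  then show "q \<in> g ` (\<Inter>n. K n)" by blast
qed blast

lemma INT_decseq_offset:
  fixes K :: "nat \<Rightarrow> 'a set"
  assumes "decseq K"
  shows "(\<Inter>n. K (n + m)) = (\<Inter>n. K n)"
proof -
  have "K (n + m) \<subseteq> K n" for n using assms by (simp add: decseq_def)
  then show ?thesis by blast
qed

lemma compact_space_rplane: "compact_space rplane"
  by (simp add: rplane_def rline_def compact_space_prod_topology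
        compact_space_Alexandroff_compactification)

lemma f_image_eq_image:
  assumes "a < -1" and "closedin rplane S" and "S \<inter> I_f a = {}"
  shows "f_image a S = f_ext a ` S"
proof -
  have "compactin (subtopology rplane (- I_f a)) S"
    using assms compact_space_rplane closedin_compact_space
    by (auto simp: compactin_subtopology)
  then have "compactin rplane (f_ext a ` S)"
    using f_ext_is_extension(1)[OF assms(1)] by (rule image_compactin)
  then have "closedin rplane (f_ext a ` S)"
    by (rule compactin_imp_closedin[OF Hausdorff_rplane])
  then show ?thesis
    using assms(3) by (simp add: f_image_def closure_of_closedin Diff_triv)
qed

text \<open>Once some \<open>K m\<close> avoids the indeterminacy set, all later sets lie in it, and there \<open>f\<close> is
  a continuous map on a compact space.\<close>

lemma f_image_INT_decseq:
  assumes "a < -1" and K: "\<And>n. closedin rplane (K n)" "decseq K" and "K m \<inter> I_f a = {}"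
  shows "f_image a (\<Inter>n. K n) = (\<Inter>n. f_image a (K n))"
proof -
  have sub: "K (n + m) \<subseteq> K m" for n using K(2) by (simp add: decseq_def)
  have disj: "K (n + m) \<inter> I_f a = {}" for n using sub assms(4) by blast
  have "f_image a (\<Inter>n. K n) = f_image a (\<Inter>n. K (n + m))"
    by (simp only: INT_decseq_offset[OF K(2)])
  also have "\<dots> = f_ext a ` (\<Inter>n. K (n + m))"
    using disj by (intro f_image_eq_image[OF assms(1)] closedin_INT K(1)) auto
  also have "\<dots> = (\<Inter>n. f_ext a ` K (n + m))"
  proof (rule image_INT_decseq_compact[OF _ Hausdorff_rplane])
    show "compact_space (subtopology rplane (K m))"
      using closedin_compact_space[OF compact_space_rplane K(1)] by (rule compact_space_subtopology)
    show "continuous_map (subtopology rplane (K m)) rplane (f_ext a)"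
      using f_ext_is_extension(1)[OF assms(1)]
      by (rule continuous_map_from_subtopology_mono) (use assms(4) in auto)
    show "closedin (subtopology rplane (K m)) (K (n + m))" for n
      using K(1) sub by (rule closedin_subset_topspace)
    show "decseq (\<lambda>n. K (n + m))" using K(2) by (simp add: decseq_def)
  qed
  also have "\<dots> = (\<Inter>n. f_image a (K (n + m)))"
    using disj by (simp add: f_image_eq_image[OF assms(1) K(1)])
  also have "\<dots> = (\<Inter>n. f_image a (K n))"
    using K(2) f_image_mono by (intro INT_decseq_offset) (simp add: decseq_def)
  finally show ?thesis .
qed


section \<open>The shift and the map\<close>

theorem theorem4p10:
  fixes a :: real and w :: "int \<rightharpoonup> nat"
  assumes "a < -1"
    and "admissible w" and "admissible (shift w)"
    and "(Some (- a), None) \<notin> R a w"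
  shows "R a (shift w) = f_image a (R a w)"
proof (cases "finite (dom w)")
  have zero: "0 \<in> dom w" using assms(2) by (rule admissible_zero_in_dom)
  have one: "1 \<in> dom w"
    using admissible_zero_in_dom[OF assms(3)] by (simp add: shift_def dom_def)
  {
    case True
    then show ?thesis
      using R_fin_shift[OF assms(1) zero one] by (simp add: R_def finite_dom_shift)
  next
    case False
    \<comment> \<open>The truncations start at radius \<open>1\<close> because position \<open>1\<close> has to survive: it becomes
      position \<open>0\<close> of the shifted word.\<close>
    define v where "v n = w |` {- int (Suc n)..int (Suc n)}" for n
    have v01: "0 \<in> dom (v n)" "1 \<in> dom (v n)" for n
      using zero one by (auto simp: v_def)
    have v_adm: "admissible (v n)" for n
      unfolding v_def by (rule admissible_restrict[OF assms(2)])
    have "shift (v n) = shift w |` {- int (Suc (Suc n))..int n}" for n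
      by (simp add: v_def shift_restrict algebra_simps)
    then have sv_adm: "admissible (shift (v n))" for n
      by (simp only: admissible_restrict[OF assms(3)])
    have v_fin: "finite (dom (v n))" for n by (simp add: v_def)
    have v_le: "v n \<subseteq>\<^sub>m w" for n by (simp add: v_def map_le_def)
    have cover: "\<exists>n. A \<subseteq> dom (v n)" if A: "finite A" "A \<subseteq> dom w" for A
    proof -
      obtain n where "A \<subseteq> {- int n..int n}"
        using A(1) by (rule finite_int_subset_symmetric)
      also have "\<dots> \<subseteq> {- int (Suc n)..int (Suc n)}" by simp
      finally have "A \<subseteq> dom (v n)" using A(2) by (simp add: v_def)
      then show ?thesis ..
    qed
    have Rw: "R a w = (\<Inter>n. R_fin a (v n))"
      using False v_adm v_fin v_le cover by (rule R_eq_INT_exhaustion)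
    have "R a (shift w) = (\<Inter>n. R_fin a (shift (v n)))"
    proof (rule R_eq_INT_exhaustion)
      show "\<exists>n. A \<subseteq> dom (shift (v n))" if "finite A" "A \<subseteq> dom (shift w)" for A
      proof -
        have "\<exists>n. (\<lambda>k. k + 1) ` A \<subseteq> dom (v n)"
          using that by (intro cover) (auto simp: shift_def)
        then show ?thesis by (auto simp: shift_def)
      qed
      show "infinite (dom (shift w))" using False by (simp add: finite_dom_shift)
      show "shift (v n) \<subseteq>\<^sub>m shift w" for n
        using v_le[of n] by (auto simp: map_le_def shift_def)
    qed (simp_all add: sv_adm v_fin finite_dom_shift)
    also have "\<dots> = (\<Inter>n. f_image a (R_fin a (v n)))"
      by (simp only: R_fin_shift[OF assms(1) v01])
    also have "\<dots> = f_image a (\<Inter>n. R_fin a (v n))"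
    proof -
      obtain m where "(Some (- a), None) \<notin> R_fin a (v m)"
        using assms(4) unfolding Rw by blast
      then have "R_fin a (v m) \<inter> I_f a = {}"
        using indeterminate_1_0_notin_R_fin[OF v01(1)] by (auto simp: I_f_def)
      moreover have "decseq (\<lambda>n. R_fin a (v n))"
        unfolding decseq_def by (intro allI impI R_fin_mono) (auto simp: v_def map_le_def)
      ultimately show ?thesis
        by (intro f_image_INT_decseq[OF assms(1) closedin_R_fin, symmetric])
    qed
    finally show ?thesis unfolding Rw .
  }
qed

end
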